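(* The cycle-free fragments of G3s + $(\Box\mathrm{Cut})$, G3s + (Cut) and G3s are identical: a sequent has a prehistoric-cycle-free proof in one of these three systems if and only if it has one in each of the others.
   Context: S4 formulas: $A ::= \bot \mid P \mid A_0\to A_1 \mid \Box A$ ($P$ atomic). Sequents $\Gamma\supset\Delta$ use finite multisets; $\Box\Gamma:=\{\Box C\mid C\in\Gamma\}$. G3s rules: (Ax) $P,\Gamma\supset\Delta,P$ ($P$ atomic); $(\bot\supset)$ $\bot,\Gamma\supset\Delta$; $(\to\supset)$ from $\Gamma\supset\Delta,A$ and $B,\Gamma\supset\Delta$ infer $A\to B,\Gamma\supset\Delta$; $(\supset\to)$ from $A,\Gamma\supset\Delta,B$ infer $\Gamma\supset\Delta,A\to B$; $(\Box\supset)$ from $A,\Box A,\Gamma\supset\Delta$ infer $\Box A,\Gamma\supset\Delta$; $(\supset\Box)$ from $\Box\Gamma\supset A$ infer $\Gamma',\Box\Gamma\supset\Delta',\Box A$. (Cut): from $\Gamma\supset\Delta,A$ and $A,\Gamma\supset\Delta$ infer $\Gamma\supset\Delta$. $(\Box\mathrm{Cut})$: from $\Gamma\supset\Delta,\Box A,\Box B$ and $\Gamma\supset\Delta,\Box(A\to B),\Box B$ infer $\Gamma\supset\Delta,\Box B$. The system G3s + $(\Box\mathrm{Cut})$ is G3s with the rule $(\Box\mathrm{Cut})$ added; G3s + (Cut) is G3s with (Cut) added. In a rule instance, formulas of $\Gamma,\Delta,\Box\Gamma$ repeated in premise(s) and conclusion are side formulas; $\Gamma',\Delta'$ (and $\Gamma,\Delta$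 in axioms) are weakening formulas; the distinguished new formula of the conclusion is principal and the distinguished formulas of the premises are active. Correspondence of symbol occurrences: a symbol occurrence in a side formula of a premise directly corresponds to the same occurrence in the conclusion; an active formula of a premise directly corresponds to the topmost occurrence of that formula as a subformula of the principal formula, with its symbol occurrences corresponding accordingly; in (Cut) the two active occurrences of the cut formula (and their symbols) correspond; in $(\Box\mathrm{Cut})$ the outermost $\Box$'s of $\Box A$, $\Box(A\to B)$ and all occurrences of $\Box B$ correspond, the two occurrences of the subformula $A$ correspond symbolwise, and the occurrences of the subformula $B$ correspond symbolwise. Correspondence is the reflexive, symmetric, transitive closure; a family is an equivalence class of $\Box$-occurrences. $i\prec j$ (prehistoric relation) if some $(\supset\Box)$ rule whose principal $\Box A$ has its outermost $\Box$ in family $j$ has a premise containing a $\Box$-occurrence of family $i$. A prehistoric cycle is $i_0\prec\cdots\prec i_{n-1}\prec i_0$ ($n\ge1$); a proof is prehistoric-cycle-free if it has none. The cycle-free fragment of a system is the set of sequents having a prehistoric-cycle-free proof in that system. (For cut-free G3s proofs, restricting $\prec$ to families introduced by $(\supset\Box)$ rules yields the same cycles, since other families have no prehistoric predecessors.) *)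

theory Defs
  imports Main "HOL-Library.Multiset"
begin

datatype 'a fm = Bot | At 'a | Imp "'a fm" "'a fm" | Box "'a fm"

text \<open>Subformula occurrence at a path (0 = left/only immediate subformula, 1 = right).
  Symbol occurrences are identified with the subformula occurrences they head.\<close>
fun subfm :: "'a fm \<Rightarrow> nat list \<Rightarrow> 'a fm option" where
  "subfm A [] = Some A"
| "subfm (Imp A B) (0 # p) = subfm A p"
| "subfm (Imp A B) (Suc 0 # p) = subfm B p"
| "subfm (Box A) (0 # p) = subfm A p"
| "subfm _ _ = None"

text \<open>In proof trees, sequents are stored as lists (so that formula occurrences are
  identified by indices).  Every rule is stated in a canonical shape, principal formula
  first; an explicit structural node Perm (permuting antecedent and succedent) lets the
  rules be applied to arbitrary occurrences.  Perm nodes do not change the underlying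
  multiset sequent and merely transport occurrences.\<close>

type_synonym 'a sequent = "'a fm list \<times> 'a fm list"

datatype rule = Ax | BotL | ImpL | ImpR | BoxL | BoxR | Cut | BoxCut
  | Perm "nat \<Rightarrow> nat" "nat \<Rightarrow> nat"

datatype 'a ptree = PT "'a sequent" rule "'a ptree list"

fun root :: "'a ptree \<Rightarrow> 'a sequent" where "root (PT s r ts) = s"
fun rule_of :: "'a ptree \<Rightarrow> rule" where "rule_of (PT s r ts) = r"
fun children :: "'a ptree \<Rightarrow> 'a ptree list" where "children (PT s r ts) = ts"

datatype system = G3s | G3s_Cut | G3s_BoxCut

fun rule_ok :: "system \<Rightarrow> rule \<Rightarrow> 'a sequent \<Rightarrow> 'a sequent list \<Rightarrow> bool" where
  "rule_ok sys Ax c ps = (\<exists>P G D. c = (At P # G, At P # D) \<and> ps = [])"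
| "rule_ok sys BotL c ps = (\<exists>G D. c = (Bot # G, D) \<and> ps = [])"
| "rule_ok sys ImpL c ps = (\<exists>A B G D. c = (Imp A B # G, D) \<and> ps = [(G, A # D), (B # G, D)])"
| "rule_ok sys ImpR c ps = (\<exists>A B G D. c = (G, Imp A B # D) \<and> ps = [(A # G, B # D)])"
| "rule_ok sys BoxL c ps = (\<exists>A G D. c = (Box A # G, D) \<and> ps = [(A # Box A # G, D)])"
| "rule_ok sys BoxR c ps = (\<exists>G G' A D'. c = (map Box G @ G', Box A # D') \<and> ps = [(map Box G, [A])])"
| "rule_ok sys Cut c ps = (sys = G3s_Cut \<and> (\<exists>A. ps = [(fst c, A # snd c), (A # fst c, snd c)]))"
| "rule_ok sys BoxCut c ps = (sys = G3s_BoxCut \<and> (\<exists>A B G D. c = (G, Box B # D) \<and>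
      ps = [(G, Box A # Box B # D), (G, Box (Imp A B) # Box B # D)]))"
| "rule_ok sys (Perm p q) c ps = (\<exists>G' D'. ps = [(G', D')] \<and>
      length G' = length (fst c) \<and> length D' = length (snd c) \<and>
      bij_betw p {..<length G'} {..<length G'} \<and> bij_betw q {..<length D'} {..<length D'} \<and>
      (\<forall>i<length G'. G' ! i = fst c ! p i) \<and> (\<forall>i<length D'. D' ! i = snd c ! q i))"

inductive valid :: "system \<Rightarrow> 'a ptree \<Rightarrow> bool" for sys where
  "rule_ok sys r s (map root ts) \<Longrightarrow> (\<forall>t\<in>set ts. valid sys t) \<Longrightarrow> valid sys (PT s r ts)"

text \<open>Local position in a rule instance: (None = conclusion | Some k = k-th premise,
  side (True = antecedent, False = succedent), index of formula, subformula path).\<close>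
type_synonym lpos = "nat option \<times> bool \<times> nat \<times> nat list"
text \<open>Global position: (address of node, side, index, subformula path).\<close>
type_synonym gpos = "nat list \<times> bool \<times> nat \<times> nat list"

definition sw :: "nat option \<Rightarrow> bool \<Rightarrow> nat \<Rightarrow> nat option \<Rightarrow> bool \<Rightarrow> nat \<Rightarrow> nat list \<Rightarrow> (lpos \<times> lpos) set" where
  "sw k s i k' s' i' q = {((k, s, i, p), (k', s', i', q @ p)) | p. True}"

fun ledges :: "rule \<Rightarrow> (lpos \<times> lpos) set" where
  "ledges Ax = {}"
| "ledges BotL = {}"
| "ledges ImpL =
     (\<Union>i. sw (Some 0) True i None True (Suc i) []) \<union> sw (Some 0) False 0 None True 0 [0]
   \<union> (\<Union>i. sw (Some 0) False (Suc i) None False i [])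
   \<union> sw (Some 1) True 0 None True 0 [1] \<union> (\<Union>i. sw (Some 1) True (Suc i) None True (Suc i) [])
   \<union> (\<Union>i. sw (Some 1) False i None False i [])"
| "ledges ImpR =
     sw (Some 0) True 0 None False 0 [0] \<union> sw (Some 0) False 0 None False 0 [1]
   \<union> (\<Union>i. sw (Some 0) True (Suc i) None True i [])
   \<union> (\<Union>i. sw (Some 0) False (Suc i) None False (Suc i) [])"
| "ledges BoxL =
     sw (Some 0) True 0 None True 0 [0] \<union> sw (Some 0) True 1 None True 0 []
   \<union> (\<Union>i. sw (Some 0) True (Suc (Suc i)) None True (Suc i) [])
   \<union> (\<Union>i. sw (Some 0) False i None False i [])"
| "ledges BoxR =
     (\<Union>i. sw (Some 0) True i None True i []) \<union> sw (Some 0) False 0 None False 0 [0]"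
| "ledges Cut =
     (\<Union>i. sw (Some 0) True i None True i []) \<union> (\<Union>i. sw (Some 0) False (Suc i) None False i [])
   \<union> sw (Some 0) False 0 (Some 1) True 0 []
   \<union> (\<Union>i. sw (Some 1) True (Suc i) None True i []) \<union> (\<Union>i. sw (Some 1) False i None False i [])"
| "ledges BoxCut =
     (\<Union>i. sw (Some 0) True i None True i []) \<union> (\<Union>i. sw (Some 1) True i None True i [])
   \<union> (\<Union>i. sw (Some 0) False (Suc (Suc i)) None False (Suc i) [])
   \<union> (\<Union>i. sw (Some 1) False (Suc (Suc i)) None False (Suc i) [])
   \<union> sw (Some 0) False 1 None False 0 [] \<union> sw (Some 1) False 1 None False 0 []
   \<union> {((Some 0, False, 0, []), (None, False, 0, [])), ((Some 1, False, 0, []), (None, False, 0, []))}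
   \<union> {((Some 0, False, 0, 0 # p), (Some 1, False, 0, 0 # 0 # p)) | p. True}
   \<union> {((Some 1, False, 0, 0 # 1 # p), (None, False, 0, 0 # p)) | p. True}"
| "ledges (Perm p q) =
     (\<Union>i. sw (Some 0) True i None True (p i) []) \<union> (\<Union>i. sw (Some 0) False i None False (q i) [])"

primrec node_at :: "nat list \<Rightarrow> 'a ptree \<Rightarrow> 'a ptree option" where
  "node_at [] t = Some t"
| "node_at (k # a) t = (if k < length (children t) then node_at a (children t ! k) else None)"

fun lift :: "nat list \<Rightarrow> lpos \<Rightarrow> gpos" where
  "lift a (None, s, i, p) = (a, s, i, p)"
| "lift a (Some k, s, i, p) = (a @ [k], s, i, p)"

fun occ_at :: "'a ptree \<Rightarrow> gpos \<Rightarrow> 'a fm option" where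
  "occ_at t (a, s, i, p) = (case node_at a t of None \<Rightarrow> None
     | Some n \<Rightarrow> (let l = (if s then fst (root n) else snd (root n)) in
                  if i < length l then subfm (l ! i) p else None))"

definition dcorr :: "'a ptree \<Rightarrow> (gpos \<times> gpos) set" where
  "dcorr t = {(lift a x, lift a y) | a x y n. node_at a t = Some n \<and> (x, y) \<in> ledges (rule_of n)
      \<and> occ_at t (lift a x) \<noteq> None \<and> occ_at t (lift a y) \<noteq> None}"

definition corr :: "'a ptree \<Rightarrow> (gpos \<times> gpos) set" where
  "corr t = (dcorr t \<union> (dcorr t)\<inverse>)\<^sup>*"

definition is_box :: "'a ptree \<Rightarrow> gpos \<Rightarrow> bool" where
  "is_box t x = (\<exists>B. occ_at t x = Some (Box B))"

text \<open>Prehistoric relation, lifted to Box-occurrences (it is invariant under correspondence,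
  i.e. it is the relation between families): x \<prec> y iff some (\<supset>Box) node, whose principal
  Box (succedent index 0) is in the family of y, has a Box-occurrence of the family of x
  in its premise.\<close>
definition prehist :: "'a ptree \<Rightarrow> (gpos \<times> gpos) set" where
  "prehist t = {(x, y). is_box t x \<and> is_box t y \<and>
     (\<exists>a n s i p. node_at a t = Some n \<and> rule_of n = BoxR \<and> is_box t (a @ [0], s, i, p)
        \<and> (x, (a @ [0], s, i, p)) \<in> corr t \<and> (y, (a, False, 0, [])) \<in> corr t)}"

definition cycle_free :: "'a ptree \<Rightarrow> bool" where
  "cycle_free t = (\<forall>x. (x, x) \<notin> (prehist t)\<^sup>+)"

definition cf_provable :: "system \<Rightarrow> 'a fm multiset \<Rightarrow> 'a fm multiset \<Rightarrow> bool" where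
  "cf_provable sys \<Gamma> \<Delta> = (\<exists>t. valid sys t \<and> mset (fst (root t)) = \<Gamma> \<and> mset (snd (root t)) = \<Delta>
      \<and> cycle_free t)"

end

(* A proof is prehistoric-cycle-free iff its Box families can be numbered so that, at every
   BoxR step, all numbers in the premise are smaller than the number of the principal Box.
   This gives a calculus of numbered formulas, in which cut elimination is proved semantically.
   A Kripke model has one relation for each number, and a formula may be both positively and
   negatively satisfied at a world, but never neither; a sequent is valid if no world satisfies
   its antecedent positively and its succedent negatively.  Totality makes Cut sound, and since
   BoxCut puts the same number n on Box A, Box (A -> B) and Box B, it is sound too: a world
   accessible at n that satisfies B negatively satisfies A or A -> B negatively.  Conversely,
   saturating a sequent without a numbered cut-free proof yields a world of a canonical model
   that refutes it. *)

theory Submission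
  imports Defs "HOL-Combinatorics.List_Permutation"
begin

section \<open>Labelled formulas and labelled cut-free proofs\<close>

datatype 'a afm = ABot | AAt 'a | AImp "'a afm" "'a afm" | ABox nat "'a afm"

primrec erase :: "'a afm \<Rightarrow> 'a fm" where
  "erase ABot = Bot"
| "erase (AAt P) = At P"
| "erase (AImp A B) = Imp (erase A) (erase B)"
| "erase (ABox n A) = Box (erase A)"

text \<open>The bound is strict because the number of a principal Box has to exceed every number in
  the premise of its BoxR step.\<close>

primrec below :: "nat \<Rightarrow> 'a afm \<Rightarrow> bool" where
  "below m ABot = True"
| "below m (AAt P) = True"
| "below m (AImp A B) = (below m A \<and> below m B)"
| "below m (ABox n A) = (n < m \<and> below m A)"

fun asub :: "'a afm \<Rightarrow> nat list \<Rightarrow> 'a afm option" where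
  "asub A [] = Some A"
| "asub (AImp A B) (0 # p) = asub A p"
| "asub (AImp A B) (Suc 0 # p) = asub B p"
| "asub (ABox n A) (0 # p) = asub A p"
| "asub _ _ = None"

type_synonym 'a aseq = "'a afm list \<times> 'a afm list"

definition eraseq :: "'a aseq \<Rightarrow> 'a sequent" where
  "eraseq c = (map erase (fst c), map erase (snd c))"

definition aocc :: "'a aseq \<Rightarrow> bool \<Rightarrow> nat \<Rightarrow> nat list \<Rightarrow> 'a afm option" where
  "aocc c s i p = (let l = (if s then fst c else snd c) in
     if i < length l then asub (l ! i) p else None)"

fun locc :: "'a aseq \<Rightarrow> (nat \<Rightarrow> 'a aseq) \<Rightarrow> lpos \<Rightarrow> 'a afm option" where
  "locc c ps (None, s, i, p) = aocc c s i p"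
| "locc c ps (Some k, s, i, p) = aocc (ps k) s i p"

text \<open>Equating whole annotated subformulas at related positions keeps the number of a Box
  constant on its family. The second clause is the prehistoric relation read numerically.\<close>

definition loc :: "rule \<Rightarrow> 'a aseq \<Rightarrow> (nat \<Rightarrow> 'a aseq) \<Rightarrow> bool" where
  "loc r c ps \<longleftrightarrow>
     (\<forall>x y A B. (x, y) \<in> ledges r \<longrightarrow> locc c ps x = Some A \<longrightarrow> locc c ps y = Some B \<longrightarrow> A = B) \<and>
     (r = BoxR \<longrightarrow> (\<exists>m A. aocc c False 0 [] = Some (ABox m A) \<and>
        (\<forall>s i p m' B. aocc (ps 0) s i p = Some (ABox m' B) \<longrightarrow> m' < m)))"

definition labelling :: "'a ptree \<Rightarrow> (nat list \<Rightarrow> 'a aseq) \<Rightarrow> bool" where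
  "labelling t F \<longleftrightarrow> (\<forall>a n. node_at a t = Some n \<longrightarrow>
     root n = eraseq (F a) \<and> loc (rule_of n) (F a) (\<lambda>k. F (a @ [k])))"

definition prv :: "'a afm list \<Rightarrow> 'a afm list \<Rightarrow> bool" where
  "prv G D \<longleftrightarrow> (\<exists>t F. valid G3s t \<and> labelling t F \<and> F [] = (G, D))"

lemma subfm_erase: "subfm (erase A) p = map_option erase (asub A p)"
  by (induction A p rule: asub.induct) auto

lemma below_asub: "below n A \<Longrightarrow> asub A p = Some (ABox m B) \<Longrightarrow> m < n"
  by (induction A p rule: asub.induct) auto

lemma below_mono: "below n A \<Longrightarrow> n \<le> m \<Longrightarrow> below m A"
  by (induction A) auto

section \<open>From numbered proofs to cycle-freeness\<close>

lemma occ_at_labelling: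
  assumes "labelling t F" "node_at a t = Some n"
  shows "occ_at t (a, s, i, p) = map_option erase (aocc (F a) s i p)"
proof -
  have "root n = eraseq (F a)" using assms unfolding labelling_def by blast
  then show ?thesis using assms(2) by (auto simp: aocc_def Let_def eraseq_def subfm_erase)
qed

lemma occ_at_SomeD:
  assumes "labelling t F" "occ_at t (a, s, i, p) = Some B"
  shows "\<exists>A. aocc (F a) s i p = Some A \<and> B = erase A"
proof -
  obtain n where "node_at a t = Some n" using assms(2) by (auto split: option.splits)
  then show ?thesis using occ_at_labelling[OF assms(1)] assms(2) by fastforce
qed

fun gocc :: "(nat list \<Rightarrow> 'a aseq) \<Rightarrow> gpos \<Rightarrow> 'a afm option" where
  "gocc F (a, s, i, p) = aocc (F a) s i p"

lemma gocc_lift: "gocc F (lift a x) = locc (F a) (\<lambda>k. F (a @ [k])) x"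
  by (cases "(a, x)" rule: lift.cases) auto

lemma erase_eq_Box: "Box B = erase A \<longleftrightarrow> (\<exists>m C. A = ABox m C \<and> B = erase C)"
  by (cases A) auto

text \<open>Annotated occurrences are invariant under \<open>corr\<close>, and every step of
  \<open>prehist\<close> strictly increases the number, so no occurrence can precede itself.\<close>

lemma labelling_cycle_free:
  assumes L: "labelling t F"
  shows "cycle_free t"
proof -
  let ?g = "gocc F"
  have occ: "\<exists>A. ?g x = Some A \<and> B = erase A" if "occ_at t x = Some B" for x B
    using that occ_at_SomeD[OF L] by (cases x) (simp only: gocc.simps)
  have d: "?g x = ?g y" if "(x, y) \<in> dcorr t" for x y
  proof -
    obtain a x' y' n where *: "x = lift a x'" "y = lift a y'" "node_at a t = Some n"
      "(x', y') \<in> ledges (rule_of n)" "occ_at t x \<noteq> None" "occ_at t y \<noteq> None"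
      using \<open>(x, y) \<in> dcorr t\<close> unfolding dcorr_def by blast
    obtain A B where AB: "?g x = Some A" "?g y = Some B"
      using *(5,6) occ by (metis not_None_eq)
    then have l: "locc (F a) (\<lambda>k. F (a @ [k])) x' = Some A"
      "locc (F a) (\<lambda>k. F (a @ [k])) y' = Some B"
      using *(1,2) by (simp_all add: gocc_lift)
    have "loc (rule_of n) (F a) (\<lambda>k. F (a @ [k]))"
      using L *(3) unfolding labelling_def by blast
    then have "A = B" using *(4) l unfolding loc_def by blast
    then show ?thesis using AB by simp
  qed
  have c: "?g x = ?g y" if "(x, y) \<in> corr t" for x y
    using that unfolding corr_def by (induction rule: rtrancl_induct) (auto dest: d)
  have lbl: "\<exists>m A. ?g x = Some (ABox m A)" if "is_box t x" for x
    using that occ unfolding is_box_def by (metis erase_eq_Box)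
  \<comment> \<open>The default 0 concerns only positions without a numbered Box; by
    \<open>lbl\<close>, \<open>prehist\<close> never relates such positions.\<close>
  define h where "h = (\<lambda>x. case ?g x of Some (ABox m A) \<Rightarrow> m | _ \<Rightarrow> 0)"
  have less: "h x < h y" if xy: "(x, y) \<in> prehist t" for x y
  proof -
    obtain a n s i p where *: "node_at a t = Some n" "rule_of n = BoxR"
      "is_box t (a @ [0], s, i, p)" "(x, (a @ [0], s, i, p)) \<in> corr t"
      "(y, (a, False, 0, [])) \<in> corr t"
      using xy unfolding prehist_def mem_Collect_eq case_prod_conv by blast
    have "loc BoxR (F a) (\<lambda>k. F (a @ [k]))" using L *(1,2) unfolding labelling_def by metis
    then obtain m A where m: "?g (a, False, 0, []) = Some (ABox m A)"
      "\<And>s i p m' B. ?g (a @ [0], s, i, p) = Some (ABox m' B) \<Longrightarrow> m' < m"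
      unfolding loc_def gocc.simps by blast
    then show ?thesis using lbl[OF *(3)] c[OF *(4)] c[OF *(5)] by (auto simp: h_def)
  qed
  have "h x < h y" if "(x, y) \<in> (prehist t)\<^sup>+" for x y
    using that by (induction rule: trancl_induct) (auto dest: less intro: less_trans)
  then show ?thesis unfolding cycle_free_def by blast
qed

section \<open>Closure of numbered provability under the rules\<close>

lemma prv_rule:
  assumes r: "rule_ok G3s r (eraseq c) (map eraseq ps)" and l: "loc r c (\<lambda>k. ps ! k)"
    and ps: "\<And>p. p \<in> set ps \<Longrightarrow> prv (fst p) (snd p)"
  shows "prv (fst c) (snd c)"
proof -
  have "\<exists>T. valid G3s (fst T) \<and> labelling (fst T) (snd T) \<and> snd T [] = ps ! k" if "k < length ps" for k
    using ps[of "ps ! k"] that unfolding prv_def by auto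
  then obtain T where T: "\<And>k. k < length ps \<Longrightarrow> valid G3s (fst (T k))"
    "\<And>k. k < length ps \<Longrightarrow> labelling (fst (T k)) (snd (T k))"
    "\<And>k. k < length ps \<Longrightarrow> snd (T k) [] = ps ! k"
    by metis
  define ts where "ts = map (\<lambda>k. fst (T k)) [0..<length ps]"
  define t where "t = PT (eraseq c) r ts"
  \<comment> \<open>The numberings of the premises are placed above the new conclusion. Out of
    range, \<open>F\<close> returns \<open>ps ! k\<close>, so that \<open>F [k]\<close> agrees with
    \<open>ps ! k\<close> for every \<open>k\<close>; \<open>loc\<close> speaks of arbitrary premise
    indices.\<close>
  define F where "F = (\<lambda>a. case a of [] \<Rightarrow> c | k # b \<Rightarrow>
    if k < length ps then snd (T k) b else ps ! k)"
  have rt: "root (fst (T k)) = eraseq (ps ! k)" if "k < length ps" for k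
  proof -
    have "node_at [] (fst (T k)) = Some (fst (T k))" by simp
    then show ?thesis using T(2,3)[OF that] unfolding labelling_def by metis
  qed
  have "map root ts = map eraseq ps" by (rule nth_equalityI) (auto simp: ts_def rt)
  then have v: "valid G3s t" unfolding t_def by (intro valid.intros) (auto simp: r ts_def T)
  have k: "(\<lambda>k. F [k]) = (\<lambda>k. ps ! k)" by (auto simp: F_def T)
  have "labelling t F"
    unfolding labelling_def
  proof (intro allI impI)
    fix a n assume n: "node_at a t = Some n"
    show "root n = eraseq (F a) \<and> loc (rule_of n) (F a) (\<lambda>k. F (a @ [k]))"
    proof (cases a)
      case Nil
      then show ?thesis using n l k by (auto simp: t_def F_def)
    next
      case (Cons k b)
      then have "k < length ps" "node_at b (fst (T k)) = Some n"
        using n by (auto simp: t_def ts_def split: if_splits)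
      then show ?thesis using T(2)[of k] Cons unfolding labelling_def by (auto simp: F_def)
    qed
  qed
  with v show ?thesis unfolding prv_def by (intro exI[of _ t] exI[of _ F]) (auto simp: F_def)
qed

text \<open>The bijections from \<open>permutation_Ex_bij\<close> are exactly the data of a
  \<open>Perm\<close> node. From here on numbered sequents can be handled as multisets.\<close>

lemma prv_perm:
  assumes "prv G' D'" "mset G = mset G'" "mset D = mset D'"
  shows "prv G D"
proof -
  obtain p where p: "bij_betw p {..<length G'} {..<length G}" "\<forall>i<length G'. G' ! i = G ! p i"
    using permutation_Ex_bij[of G' G] assms(2) by auto
  obtain q where q: "bij_betw q {..<length D'} {..<length D}" "\<forall>i<length D'. D' ! i = D ! q i"
    using permutation_Ex_bij[of D' D] assms(3) by auto
  have len: "length G = length G'" "length D = length D'"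
    using assms(2,3) mset_eq_length by blast+
  have "p i < length G" if "i < length G'" for i using p(1) that by (auto dest: bij_betwE)
  moreover have "q i < length D" if "i < length D'" for i using q(1) that by (auto dest: bij_betwE)
  ultimately show ?thesis
    using prv_rule[of "Perm p q" "(G, D)" "[(G', D')]"] p q len assms(1)
    by (auto simp: eraseq_def loc_def sw_def aocc_def Let_def split: if_splits)
qed

lemma prv_Ax: "prv (AAt P # G) (AAt P # D)"
  using prv_rule[of Ax "(AAt P # G, AAt P # D)" "[]"] by (auto simp: eraseq_def loc_def)

lemma prv_BotL: "prv (ABot # G) D"
  using prv_rule[of BotL "(ABot # G, D)" "[]"] by (auto simp: eraseq_def loc_def)

lemma prv_ImpL:
  assumes "prv G (A # D)" "prv (B # G) D"
  shows "prv (AImp A B # G) D"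
proof -
  have "loc ImpL (AImp A B # G, D) (\<lambda>k. [(G, A # D), (B # G, D)] ! k)"
    unfolding loc_def by (auto simp: sw_def aocc_def Let_def split: if_splits)
  moreover have "prv (fst p) (snd p)" if "p \<in> set [(G, A # D), (B # G, D)]" for p
    using that assms by auto
  ultimately show ?thesis
    using prv_rule[of ImpL "(AImp A B # G, D)" "[(G, A # D), (B # G, D)]"]
    by (simp add: eraseq_def)
qed

lemma prv_ImpR:
  assumes "prv (A # G) (B # D)"
  shows "prv G (AImp A B # D)"
proof -
  have "loc ImpR (G, AImp A B # D) (\<lambda>k. [(A # G, B # D)] ! k)"
    unfolding loc_def by (auto simp: sw_def aocc_def Let_def split: if_splits)
  from prv_rule[OF _ this] assms show ?thesis by (auto simp: eraseq_def)
qed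

lemma prv_BoxL:
  assumes "prv (A # ABox n A # G) D"
  shows "prv (ABox n A # G) D"
proof -
  have "loc BoxL (ABox n A # G, D) (\<lambda>k. [(A # ABox n A # G, D)] ! k)"
    unfolding loc_def by (auto simp: sw_def aocc_def Let_def split: if_splits)
  from prv_rule[OF _ this] assms show ?thesis by (auto simp: eraseq_def)
qed

abbreviation boxed :: "'a afm \<Rightarrow> bool" where
  "boxed C \<equiv> \<exists>n A. C = ABox n A"

lemma prv_BoxR:
  assumes "prv X [A]" and X: "\<forall>C\<in>set X. boxed C \<and> below n C" and "below n A"
  shows "prv (X @ G) (ABox n A # D)"
proof -
  have "\<exists>Y. map erase X = map Box Y" using X
    by (induction X) (auto, metis list.simps(9))
  then have r: "rule_ok G3s BoxR (eraseq (X @ G, ABox n A # D)) (map eraseq [(X, [A])])"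
    by (auto simp: eraseq_def)
  \<comment> \<open>The conditions on whole formulas become the bound on each single Box occurrence
    that \<open>loc\<close> demands.\<close>
  have "m' < n" if "C \<in> insert A (set X)" "asub C p = Some (ABox m' B)" for C p m' B
    using that assms(2,3) below_asub by blast
  then have "loc BoxR (X @ G, ABox n A # D) (\<lambda>k. [(X, [A])] ! k)"
    unfolding loc_def
    by (auto simp: sw_def aocc_def Let_def nth_append split: if_splits) (metis nth_mem)
  then show ?thesis using prv_rule[OF r] assms(1) by simp
qed

section \<open>Semantics\<close>

text \<open>Closure under reflexivity and transitivity supplies the preorders of S4, whatever the
  relations \<open>S m\<close> are; \<open>M\<close> selects the admissible numbers.\<close>

definition acc :: "(nat \<Rightarrow> 'w \<Rightarrow> 'w \<Rightarrow> bool) \<Rightarrow> (nat \<Rightarrow> bool) \<Rightarrow> ('w \<times> 'w) set" where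
  "acc S M = {(w, v). \<exists>m. M m \<and> S m w v}\<^sup>*"

text \<open>The Boolean says whether the formula is satisfied positively or negatively.  A box
  numbered \<open>n\<close> over a formula that is not \<open>below n\<close> is never the principal formula of a
  numbered BoxR step, hence it must be negatively satisfied everywhere.  The two accessibility
  relations are chosen so that positive boxes persist along the steps that can carry them in
  BoxR, while for \<open>below n A\<close> the positive relation is contained in the negative one, which
  gives totality.\<close>
primrec sat :: "(nat \<Rightarrow> 'w \<Rightarrow> 'w \<Rightarrow> bool) \<Rightarrow> ('w \<Rightarrow> 'a \<Rightarrow> bool) \<Rightarrow> 'a afm \<Rightarrow> bool \<Rightarrow> 'w \<Rightarrow> bool"
where
  "sat S V ABot b w = (\<not> b)"
| "sat S V (AAt P) b w = (V w P = b)"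
| "sat S V (AImp A B) b w = (if b then sat S V A False w \<or> sat S V B True w
     else sat S V A True w \<and> sat S V B False w)"
| "sat S V (ABox n A) b w = (if b
     then \<forall>v. (w, v) \<in> acc S (\<lambda>m. below m (ABox n A)) \<longrightarrow> sat S V A True v
     else \<not> below n A \<or> (\<exists>v. (w, v) \<in> acc S (\<lambda>m. n \<le> m) \<and> sat S V A False v))"

lemma acc_mono: "(\<And>m. M m \<Longrightarrow> N m) \<Longrightarrow> (w, v) \<in> acc S M \<Longrightarrow> (w, v) \<in> acc S N"
  unfolding acc_def by (erule rtrancl_mono[THEN subsetD, rotated]) auto

lemma acc_refl [simp]: "(w, w) \<in> acc S M"
  unfolding acc_def by simp

lemma acc_trans: "(w, v) \<in> acc S M \<Longrightarrow> (v, u) \<in> acc S M \<Longrightarrow> (w, u) \<in> acc S M"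
  unfolding acc_def by (rule rtrancl_trans)

text \<open>If a Box fails positively because of some \<open>v\<close>, its body holds negatively at
  \<open>v\<close> by induction, and \<open>v\<close> is also accessible for the negative clause,
  since \<open>below m (ABox n A)\<close> implies \<open>n \<le> m\<close>.\<close>

lemma sat_total: "sat S V A True w \<or> sat S V A False w"
proof (induction A arbitrary: w)
  case (ABox n A)
  have "(w, v) \<in> acc S (\<lambda>m. n \<le> m)" if "(w, v) \<in> acc S (\<lambda>m. below m (ABox n A))" for v
    using that by (rule acc_mono[rotated]) auto
  then show ?case using ABox by auto
qed auto

text \<open>From \<open>below n C\<close> and \<open>n \<le> m\<close> follows
  \<open>below m C\<close>, so the step to \<open>v\<close> is one over which the Box already
  quantifies; transitivity then keeps the Box true. This carries the side formulas of BoxR to the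
  premise.\<close>

lemma sat_boxed_acc:
  assumes "sat S V C True w" "boxed C" "below n C" "(w, v) \<in> acc S (\<lambda>m. n \<le> m)"
  shows "sat S V C True v"
proof -
  obtain k A where C: "C = ABox k A" using assms(2) by blast
  have "(w, v) \<in> acc S (\<lambda>m. below m C)"
    using assms(4) by (rule acc_mono[rotated]) (use assms(3) below_mono in blast)
  then show ?thesis using assms(1) acc_trans[of w v S] unfolding C by auto
qed

section \<open>Soundness\<close>

primrec annotate :: "(nat list \<Rightarrow> nat) \<Rightarrow> 'a fm \<Rightarrow> 'a afm" where
  "annotate g Bot = ABot"
| "annotate g (At P) = AAt P"
| "annotate g (Imp A B) = AImp (annotate (\<lambda>p. g (0 # p)) A) (annotate (\<lambda>p. g (1 # p)) B)"
| "annotate g (Box A) = ABox (g []) (annotate (\<lambda>p. g (0 # p)) A)"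

lemma erase_annotate [simp]: "erase (annotate g A) = A"
  by (induction A arbitrary: g) auto

lemma annotate_cong:
  "(\<And>p B. subfm A p = Some (Box B) \<Longrightarrow> g p = h p) \<Longrightarrow> annotate g A = annotate h A"
proof (induction A arbitrary: g h)
  case (Imp A B)
  have "annotate (\<lambda>p. g (0 # p)) A = annotate (\<lambda>p. h (0 # p)) A"
    by (rule Imp.IH(1), rule Imp.prems, simp)
  moreover have "annotate (\<lambda>p. g (1 # p)) B = annotate (\<lambda>p. h (1 # p)) B"
    by (rule Imp.IH(2), rule Imp.prems, simp)
  ultimately show ?case by simp
next
  case (Box A)
  have "annotate (\<lambda>p. g (0 # p)) A = annotate (\<lambda>p. h (0 # p)) A"
    by (rule Box.IH, rule Box.prems, simp)
  moreover have "g [] = h []" by (rule Box.prems) simp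
  ultimately show ?case by simp
qed auto

lemma below_annotate:
  "(\<And>p B. subfm A p = Some (Box B) \<Longrightarrow> g p < n) \<Longrightarrow> below n (annotate g A)"
proof (induction A arbitrary: g)
  case (Imp A B)
  have "below n (annotate (\<lambda>p. g (0 # p)) A)"
    by (rule Imp.IH(1), rule Imp.prems, simp)
  moreover have "below n (annotate (\<lambda>p. g (1 # p)) B)"
    by (rule Imp.IH(2), rule Imp.prems, simp)
  ultimately show ?case by simp
next
  case (Box A)
  have "below n (annotate (\<lambda>p. g (0 # p)) A)"
    by (rule Box.IH, rule Box.prems, simp)
  moreover have "g [] < n" by (rule Box.prems) simp
  ultimately show ?case by simp
qed auto

lemma subfm_append: "subfm A (p @ q) = Option.bind (subfm A p) (\<lambda>B. subfm B q)"
  by (induction A p rule: subfm.induct) auto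

text \<open>The counterpart of \<open>labelling\<close> for plain proofs in any of the three
  systems, with numbers attached to positions. Only Box positions are constrained, since
  correspondence also links other symbols.\<close>

definition good_labels :: "'a ptree \<Rightarrow> (gpos \<Rightarrow> nat) \<Rightarrow> bool" where
  "good_labels t f \<longleftrightarrow>
     (\<forall>x y. (x, y) \<in> dcorr t \<longrightarrow> is_box t x \<longrightarrow> is_box t y \<longrightarrow> f x = f y) \<and>
     (\<forall>a n s i p. node_at a t = Some n \<longrightarrow> rule_of n = BoxR \<longrightarrow> is_box t (a @ [0], s, i, p) \<longrightarrow>
        is_box t (a, False, 0, []) \<longrightarrow> f (a @ [0], s, i, p) < f (a, False, 0, []))"

fun at_seq :: "'a ptree \<Rightarrow> nat option \<Rightarrow> 'a sequent" where
  "at_seq n None = root n"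
| "at_seq n (Some k) = root (children n ! k)"

definition side :: "bool \<Rightarrow> 'a sequent \<Rightarrow> 'a fm list" where
  "side s c = (if s then fst c else snd c)"

text \<open>The formula \<open>A\<close> is meant to stand at path \<open>q\<close> of occurrence
  \<open>i\<close>. Keeping \<open>q\<close> explicit lets the annotation of a compound formula
  split into those of its parts at the same occurrence.\<close>

definition lab :: "(gpos \<Rightarrow> nat) \<Rightarrow> nat list \<Rightarrow> nat option \<Rightarrow> bool \<Rightarrow> nat \<Rightarrow> nat list \<Rightarrow> 'a fm \<Rightarrow> 'a afm"
where
  "lab f a k s i q A = annotate (\<lambda>p. f (lift a (k, s, i, q @ p))) A"

text \<open>The parameter \<open>k\<close> allows a premise to be read from the address of its
  conclusion, which is the frame in which \<open>ledges\<close> relates occurrences.\<close>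

definition refuted where
  "refuted S V f a k c w \<longleftrightarrow>
     (\<forall>i<length (fst c). sat S V (lab f a k True i [] (fst c ! i)) True w) \<and>
     (\<forall>i<length (snd c). sat S V (lab f a k False i [] (snd c ! i)) False w)"

section \<open>Transport of numbers along a rule instance\<close>

lemma node_at_append: "node_at (a @ b) t = Option.bind (node_at a t) (node_at b)"
  by (induction a arbitrary: t) auto

lemma occ_at_lift:
  assumes "node_at a t = Some n" "\<And>j. k = Some j \<Longrightarrow> j < length (children n)"
    "i < length (side s (at_seq n k))"
  shows "occ_at t (lift a (k, s, i, p)) = subfm (side s (at_seq n k) ! i) p"
  using assms by (cases k) (auto simp: node_at_append side_def Let_def)

context
  fixes t :: "'a ptree" and f a n
  assumes good: "good_labels t f" and n: "node_at a t = Some n"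
begin

lemma edge_label:
  assumes "((k, s, i, p), (k', s', i', p')) \<in> ledges (rule_of n)"
    "\<And>j. k = Some j \<Longrightarrow> j < length (children n)" "\<And>j. k' = Some j \<Longrightarrow> j < length (children n)"
    "i < length (side s (at_seq n k))" "i' < length (side s' (at_seq n k'))"
    "subfm (side s (at_seq n k) ! i) p = Some (Box B)"
    "subfm (side s' (at_seq n k') ! i') p' = Some (Box B')"
  shows "f (lift a (k, s, i, p)) = f (lift a (k', s', i', p'))"
proof -
  have o: "occ_at t (lift a (k, s, i, p)) = Some (Box B)"
    "occ_at t (lift a (k', s', i', p')) = Some (Box B')"
    using assms n by (simp_all only: occ_at_lift)
  then have "(lift a (k, s, i, p), lift a (k', s', i', p')) \<in> dcorr t"
    unfolding dcorr_def using n assms(1) by blast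
  then show ?thesis using good o unfolding good_labels_def is_box_def by blast
qed

text \<open>A Box at path \<open>p\<close> of \<open>A\<close> stands at \<open>q @ p\<close> in one
  occurrence and at \<open>q' @ p\<close> in the other, and \<open>edge_label\<close> equates the
  two numbers.\<close>

lemma lab_eq:
  assumes "\<And>p. ((k, s, i, q @ p), (k', s', i', q' @ p)) \<in> ledges (rule_of n)"
    "\<And>j. k = Some j \<Longrightarrow> j < length (children n)" "\<And>j. k' = Some j \<Longrightarrow> j < length (children n)"
    "i < length (side s (at_seq n k))" "i' < length (side s' (at_seq n k'))"
    "subfm (side s (at_seq n k) ! i) q = Some A"
    "subfm (side s' (at_seq n k') ! i') q' = Some A"
  shows "lab f a k s i q A = lab f a k' s' i' q' A"
  unfolding lab_def
proof (rule annotate_cong)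
  fix p B assume "subfm A p = Some (Box B)"
  then show "f (lift a (k, s, i, q @ p)) = f (lift a (k', s', i', q' @ p))"
    by (intro edge_label[of k s i "q @ p" k' s' i' "q' @ p" B B] assms) (simp_all add: subfm_append assms)
qed

end

lemma lab_simps [simp]:
  "lab f a k s i q Bot = ABot"
  "lab f a k s i q (At P) = AAt P"
  "lab f a k s i q (Imp A B) = AImp (lab f a k s i (q @ [0]) A) (lab f a k s i (q @ [1]) B)"
  "lab f a k s i q (Box A) = ABox (f (lift a (k, s, i, q))) (lab f a k s i (q @ [0]) A)"
  by (simp_all add: lab_def)

lemma refuted_child: "refuted S V f (a @ [j]) None c w = refuted S V f a (Some j) c w"
  by (simp add: refuted_def lab_def)

text \<open>Rules are read upwards: a world refuting the conclusion also refutes a premise, except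
  that for BoxR the premise is refuted at an accessible world. Hence the induction generalises over
  \<open>w\<close>.\<close>

lemma soundness:
  assumes "valid sys n" "node_at a t = Some n" "good_labels t f"
  shows "\<not> refuted S V f a None (root n) w"
  using assms(1,2)
proof (induction arbitrary: a w)
  case (1 r c ts)
  \<comment> \<open>In each case \<open>le\<close> first identifies the annotated formulas of the
    premises with those of the conclusion, or with each other for the active formulas of the two cut
    rules. What then remains is an argument about \<open>sat\<close>.\<close>
  note le = lab_eq[OF assms(3) 1(3)]
  have IH: "\<not> refuted S V f a (Some j) (root (ts ! j)) w" if "j < length ts" for j w
  proof -
    have "node_at (a @ [j]) t = Some (ts ! j)" using 1(3) that by (simp add: node_at_append)
    then show ?thesis using 1(2) that refuted_child by (metis nth_mem)
  qed
  show ?case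
  proof
    assume "refuted S V f a None (root (PT c r ts)) w"
    then have R: "\<And>i. i < length (fst c) \<Longrightarrow> sat S V (lab f a None True i [] (fst c ! i)) True w"
      "\<And>i. i < length (snd c) \<Longrightarrow> sat S V (lab f a None False i [] (snd c ! i)) False w"
      unfolding refuted_def by auto
    show False
    proof (cases r)
      case Ax
      then obtain P G D where "c = (At P # G, At P # D)" using 1(1) by auto
      then show False using R(1)[of 0] R(2)[of 0] by simp
    next
      case BotL
      then obtain G D where "c = (Bot # G, D)" using 1(1) by auto
      then show False using R(1)[of 0] by simp
    next
      case ImpL
      then obtain A B G D where c: "c = (Imp A B # G, D)" and
        ts: "map root ts = [(G, A # D), (B # G, D)]" using 1(1) by auto
      have l: "length ts = 2" using arg_cong[OF ts, of length] by simp
      have r: "root (ts ! 0) = (G, A # D)" "root (ts ! 1) = (B # G, D)"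
        using nth_map[of 0 ts root] nth_map[of 1 ts root] l ts by auto
      note simps = ImpL c r r[simplified] l side_def sw_def
      have e: "lab f a (Some 0) True i [] (G ! i) = lab f a None True (Suc i) [] (G ! i)"
        if "i < length G" for i by (rule le) (use that in \<open>auto simp: simps\<close>)
      have e2: "lab f a (Some 0) False 0 [] A = lab f a None True 0 [0] A"
        by (rule le) (auto simp: simps)
      have e3: "lab f a (Some 0) False (Suc i) [] (D ! i) = lab f a None False i [] (D ! i)"
        if "i < length D" for i by (rule le) (use that in \<open>auto simp: simps\<close>)
      have e4: "lab f a (Some 1) True 0 [] B = lab f a None True 0 [1] B"
        by (rule le) (auto simp: simps)
      have e5: "lab f a (Some 1) True (Suc i) [] (G ! i) = lab f a None True (Suc i) [] (G ! i)"
        if "i < length G" for i by (rule le) (use that in \<open>auto simp: simps\<close>)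
      have e6: "lab f a (Some 1) False i [] (D ! i) = lab f a None False i [] (D ! i)"
        if "i < length D" for i by (rule le) (use that in \<open>auto simp: simps\<close>)
      have G: "\<And>i. i < length G \<Longrightarrow> sat S V (lab f a None True (Suc i) [] (G ! i)) True w"
        using R(1)[of "Suc _"] c by simp
      have "sat S V (lab f a None True 0 [0] A) False w \<or> sat S V (lab f a None True 0 [1] B) True w"
        using R(1)[of 0] c by simp
      then show False
        using IH[of 0 w] IH[of 1 w] G R(2) unfolding refuted_def
        by (auto simp: l r r[simplified] c All_less_Suc2 e e2 e3 e4[simplified] e5[simplified] e6[simplified])
    next
      case ImpR
      then obtain A B G D where c: "c = (G, Imp A B # D)" and
        ts: "map root ts = [(A # G, B # D)]" using 1(1) by auto
      have l: "length ts = 1" using arg_cong[OF ts, of length] by simp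
      have r: "root (ts ! 0) = (A # G, B # D)" using nth_map[of 0 ts root] l ts by auto
      note simps = ImpR c r l side_def sw_def
      have e: "lab f a (Some 0) True 0 [] A = lab f a None False 0 [0] A"
        by (rule le) (auto simp: simps)
      have e2: "lab f a (Some 0) False 0 [] B = lab f a None False 0 [1] B"
        by (rule le) (auto simp: simps)
      have e3: "lab f a (Some 0) True (Suc i) [] (G ! i) = lab f a None True i [] (G ! i)"
        if "i < length G" for i by (rule le) (use that in \<open>auto simp: simps\<close>)
      have e4: "lab f a (Some 0) False (Suc i) [] (D ! i) = lab f a None False (Suc i) [] (D ! i)"
        if "i < length D" for i by (rule le) (use that in \<open>auto simp: simps\<close>)
      show False
        using IH[of 0 w] R(1) R(2)[of 0] R(2)[of "Suc _"] unfolding refuted_def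
        by (auto simp: l r c All_less_Suc2 e e2 e3 e4)
    next
      case BoxL
      then obtain A G D where c: "c = (Box A # G, D)" and
        ts: "map root ts = [(A # Box A # G, D)]" using 1(1) by auto
      have l: "length ts = 1" using arg_cong[OF ts, of length] by simp
      have r: "root (ts ! 0) = (A # Box A # G, D)" using nth_map[of 0 ts root] l ts by auto
      note simps = BoxL c r l side_def sw_def
      have e: "lab f a (Some 0) True 0 [] A = lab f a None True 0 [0] A"
        by (rule le) (auto simp: simps)
      have e2: "lab f a (Some 0) True (Suc 0) [] (Box A) = lab f a None True 0 [] (Box A)"
        by (rule le) (auto simp: simps)
      have e3: "lab f a (Some 0) True (Suc (Suc i)) [] (G ! i) = lab f a None True (Suc i) [] (G ! i)"
        if "i < length G" for i by (rule le) (use that in \<open>auto simp: simps\<close>)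
      have e4: "lab f a (Some 0) False i [] (D ! i) = lab f a None False i [] (D ! i)"
        if "i < length D" for i by (rule le) (use that in \<open>auto simp: simps\<close>)
      have B: "sat S V (lab f a None True 0 [] (Box A)) True w" using R(1)[of 0] c by simp
      \<comment> \<open>The world \<open>w\<close> is accessible from itself.\<close>
      then have "sat S V (lab f a None True 0 [0] A) True w" by simp
      then show False
        using B IH[of 0 w] R(1)[of "Suc _"] R(2) unfolding refuted_def
        by (auto simp: l r c All_less_Suc2 e e2 e3 e4 simp del: lab_simps sat.simps)
    next
      case BoxR
      then obtain X G A D where c: "c = (map Box X @ G, Box A # D)" and
        ts: "map root ts = [(map Box X, [A])]" using 1(1) by auto
      have l: "length ts = 1" using arg_cong[OF ts, of length] by simp
      have r: "root (ts ! 0) = (map Box X, [A])" using nth_map[of 0 ts root] l ts by auto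
      note simps = BoxR c r l side_def sw_def nth_append
      have e: "lab f a (Some 0) True i [] (Box (X ! i)) = lab f a None True i [] (Box (X ! i))"
        if "i < length X" for i by (rule le) (use that in \<open>auto simp: simps\<close>)
      have e2: "lab f a (Some 0) False 0 [] A = lab f a None False 0 [0] A"
        by (rule le) (auto simp: simps)
      let ?m = "f (lift a (None, False, 0, []))"
      have lt: "f (a @ [0], s, i, p) < ?m" if "is_box t (a @ [0], s, i, p)" for s i p
      proof -
        have "occ_at t (lift a (None, False, 0, [])) = Some (Box A)"
          by (subst occ_at_lift[OF 1(3)]) (auto simp: simps)
        then have "is_box t (a, False, 0, [])" unfolding is_box_def by simp
        then show ?thesis using assms(3) 1(3) BoxR that unfolding good_labels_def by fastforce
      qed
      \<comment> \<open>All Boxes of the premise are prehistoric predecessors of the principal one,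
        so every premise formula is below its number.\<close>
      have bel: "below ?m (lab f a (Some 0) s i [] C)"
        if "i < length (side s (root (ts ! 0)))" "C = side s (root (ts ! 0)) ! i" for s i C
        unfolding lab_def
      proof (rule below_annotate)
        fix p B assume p: "subfm C p = Some (Box B)"
        have "occ_at t (lift a (Some 0, s, i, p)) = subfm C p"
          by (subst occ_at_lift[OF 1(3)]) (use that l in auto)
        then show "f (lift a (Some 0, s, i, [] @ p)) < ?m"
          using lt p unfolding is_box_def by simp
      qed
      have b1: "below ?m (lab f a None True i [] (Box (X ! i)))" if "i < length X" for i
        using bel[of i True "Box (X ! i)"] that by (simp add: e[symmetric] r side_def del: lab_simps)
      have b2: "below ?m (lab f a None False 0 [0] A)"
      proof -
        have "below ?m (lab f a (Some 0) False 0 [] A)" by (rule bel) (auto simp: r side_def)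
        then show ?thesis by (simp only: e2)
      qed
      \<comment> \<open>By \<open>b2\<close> the negative clause cannot hold by default, so it
        yields a genuine accessible world.\<close>
      obtain v where v: "(w, v) \<in> acc S (\<lambda>m. ?m \<le> m)" "sat S V (lab f a None False 0 [0] A) False v"
      proof -
        have "sat S V (ABox ?m (lab f a None False 0 [0] A)) False w" using R(2)[of 0] c by simp
        then show ?thesis using b2 that unfolding sat.simps by metis
      qed
      have "sat S V (lab f a None True i [] (Box (X ! i))) True v" if "i < length X" for i
        by (rule sat_boxed_acc[OF _ _ b1 v(1)])
          (use that R(1)[of i] in \<open>auto simp: c nth_append simp del: sat.simps\<close>)
      then show False using IH[of 0 v] v(2) unfolding refuted_def
        by (auto simp: l r e e2 simp del: sat.simps lab_simps)
    next
      case Cut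
      then obtain A where ts: "map root ts = [(fst c, A # snd c), (A # fst c, snd c)]"
        using 1(1) by auto
      have l: "length ts = 2" using arg_cong[OF ts, of length] by simp
      have r: "root (ts ! 0) = (fst c, A # snd c)" "root (ts ! 1) = (A # fst c, snd c)"
        using nth_map[of 0 ts root] nth_map[of 1 ts root] l ts by auto
      note simps = Cut r r[simplified] l side_def sw_def
      have e: "lab f a (Some 0) True i [] (fst c ! i) = lab f a None True i [] (fst c ! i)"
        if "i < length (fst c)" for i by (rule le) (use that in \<open>auto simp: simps\<close>)
      have e2: "lab f a (Some 0) False (Suc i) [] (snd c ! i) = lab f a None False i [] (snd c ! i)"
        if "i < length (snd c)" for i by (rule le) (use that in \<open>auto simp: simps\<close>)
      have e3: "lab f a (Some 0) False 0 [] A = lab f a (Some 1) True 0 [] A"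
        by (rule le) (auto simp: simps)
      have e4: "lab f a (Some 1) True (Suc i) [] (fst c ! i) = lab f a None True i [] (fst c ! i)"
        if "i < length (fst c)" for i by (rule le) (use that in \<open>auto simp: simps\<close>)
      have e5: "lab f a (Some 1) False i [] (snd c ! i) = lab f a None False i [] (snd c ! i)"
        if "i < length (snd c)" for i by (rule le) (use that in \<open>auto simp: simps\<close>)
      \<comment> \<open>By totality the cut formula is positive at \<open>w\<close>, which refutes
        the second premise, or negative, which refutes the first.\<close>
      show False
        using sat_total[of S V "lab f a (Some 1) True 0 [] A" w] IH[of 0 w] IH[of 1 w] R
        unfolding refuted_def
        by (auto simp: l r r[simplified] All_less_Suc2 e e2 e3[simplified] e4[simplified] e5[simplified])
    next
      case BoxCut
      then obtain A B G D where c: "c = (G, Box B # D)" and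
        ts: "map root ts = [(G, Box A # Box B # D), (G, Box (Imp A B) # Box B # D)]"
        using 1(1) by auto
      have l: "length ts = 2" using arg_cong[OF ts, of length] by simp
      have r: "root (ts ! 0) = (G, Box A # Box B # D)"
        "root (ts ! 1) = (G, Box (Imp A B) # Box B # D)"
        using nth_map[of 0 ts root] nth_map[of 1 ts root] l ts by auto
      note simps = BoxCut c r r[simplified] l side_def sw_def
      have e: "lab f a (Some 0) True i [] (G ! i) = lab f a None True i [] (G ! i)"
        "lab f a (Some (Suc 0)) True i [] (G ! i) = lab f a None True i [] (G ! i)"
        if "i < length G" for i by (rule le; use that in \<open>auto simp: simps\<close>)+
      have e2: "lab f a (Some 0) False (Suc (Suc i)) [] (D ! i) = lab f a None False (Suc i) [] (D ! i)"
        "lab f a (Some (Suc 0)) False (Suc (Suc i)) [] (D ! i) = lab f a None False (Suc i) [] (D ! i)"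
        if "i < length D" for i by (rule le; use that in \<open>auto simp: simps\<close>)+
      have e3: "lab f a (Some 0) False (Suc 0) [] (Box B) = lab f a None False 0 [] (Box B)"
        "lab f a (Some (Suc 0)) False (Suc 0) [] (Box B) = lab f a None False 0 [] (Box B)"
        by (rule le; auto simp: simps)+
      have e4: "lab f a (Some 0) False 0 [0] A = lab f a (Some (Suc 0)) False 0 [0, 0] A"
        by (rule le) (auto simp: simps)
      have e5: "lab f a (Some (Suc 0)) False 0 [0, 1] B = lab f a None False 0 [0] B"
        by (rule le) (auto simp: simps)
      let ?m = "f (lift a (None, False, 0, []))"
      have m: "f (lift a (Some 0, False, 0, [])) = ?m" "f (lift a (Some (Suc 0), False, 0, [])) = ?m"
        by (rule edge_label[OF assms(3) 1(3), where B' = B]; auto simp: simps)+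
      let ?A = "lab f a (Some (Suc 0)) False 0 [0, 0] A" and ?B = "lab f a None False 0 [0] B"
      \<comment> \<open>The two active Boxes receive the number of the principal Box, and
        \<open>A\<close> and \<open>B\<close> are annotated consistently in both. This is where the
        correspondence chosen for BoxCut enters.\<close>
      have l0: "lab f a (Some 0) False 0 [] (Box A) = ABox ?m ?A"
        "lab f a (Some (Suc 0)) False 0 [] (Box (Imp A B)) = ABox ?m (AImp ?A ?B)"
        using m e4 e5 by simp_all
      have B: "sat S V (ABox ?m ?B) False w" using R(2)[of 0] c by simp
      \<comment> \<open>At the world where \<open>?B\<close> is negative, totality makes
        \<open>?A\<close> negative, or positive and so the implication negative. If instead
        \<open>?B\<close> is not below \<open>?m\<close>, neither is the implication, and its Box is
        negative by default.\<close>
      then have "sat S V (ABox ?m ?A) False w \<or> sat S V (ABox ?m (AImp ?A ?B)) False w"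
        using sat_total[of S V ?A] by auto
      then show False
        using B IH[of 0 w] IH[of 1 w] R(1) R(2)[of 0] R(2)[of "Suc _"] unfolding refuted_def
        by (auto simp: l r r[simplified] c All_less_Suc2 e e2 e3 l0 simp del: sat.simps lab_simps)
    next
      case (Perm p q)
      then obtain G D where ts: "map root ts = [(G, D)]" and
        len: "length G = length (fst c)" "length D = length (snd c)" and
        p: "bij_betw p {..<length G} {..<length G}" "bij_betw q {..<length D} {..<length D}" and
        nth: "\<forall>i<length G. G ! i = fst c ! p i" "\<forall>i<length D. D ! i = snd c ! q i"
        using 1(1) by auto
      have l: "length ts = 1" using arg_cong[OF ts, of length] by simp
      have r: "root (ts ! 0) = (G, D)" using nth_map[of 0 ts root] l ts by auto
      have b: "i < length G \<Longrightarrow> p i < length G" "i < length D \<Longrightarrow> q i < length D" for i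
        using p by (auto dest: bij_betwE)
      note simps = Perm r l side_def sw_def
      have e: "lab f a (Some 0) True i [] (fst c ! p i) = lab f a None True (p i) [] (fst c ! p i)"
        if "i < length G" for i by (rule le) (use that b len nth in \<open>auto simp: simps\<close>)
      have e2: "lab f a (Some 0) False i [] (snd c ! q i) = lab f a None False (q i) [] (snd c ! q i)"
        if "i < length D" for i by (rule le) (use that b len nth in \<open>auto simp: simps\<close>)
      show False using IH[of 0 w] R b len nth unfolding refuted_def
        by (auto simp: l r e e2)
    qed
  qed
qed

section \<open>Completeness\<close>

text \<open>The last clause does not name a successor world; it stores an unprovable BoxR premise
  from which one can be built later. The list \<open>X\<close> keeps that premise finite.\<close>

definition hintikka :: "'a afm set \<times> 'a afm set \<Rightarrow> bool" where
  "hintikka w \<longleftrightarrow> ABot \<notin> fst w \<and> (\<forall>P. AAt P \<in> fst w \<longrightarrow> AAt P \<notin> snd w) \<and>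
     (\<forall>A B. AImp A B \<in> fst w \<longrightarrow> A \<in> snd w \<or> B \<in> fst w) \<and>
     (\<forall>A B. AImp A B \<in> snd w \<longrightarrow> A \<in> fst w \<and> B \<in> snd w) \<and>
     (\<forall>n A. ABox n A \<in> fst w \<longrightarrow> A \<in> fst w) \<and>
     (\<forall>n A. ABox n A \<in> snd w \<longrightarrow> below n A \<longrightarrow>
        (\<exists>X. {C \<in> fst w. boxed C \<and> below n C} \<subseteq> set X \<and> \<not> prv X [A]))"

definition prime :: "'a afm \<Rightarrow> bool" where
  "prime C \<longleftrightarrow> boxed C \<or> (\<exists>P. C = AAt P)"

text \<open>Worlds are pairs of sets while \<open>prv\<close> concerns lists. What is remembered of
  unprovability is one finite sequent covering all formulas to which Ax or BoxR could apply.\<close>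

definition unprovable_primes :: "'a afm set \<Rightarrow> 'a afm set \<Rightarrow> bool" where
  "unprovable_primes L R \<longleftrightarrow> (\<exists>X Y. \<not> prv X Y \<and>
     (\<forall>C\<in>L. prime C \<longrightarrow> C \<in> set X) \<and> (\<forall>C\<in>R. prime C \<longrightarrow> C \<in> set Y))"

text \<open>\<open>X\<close> collects the boxes that have already been unfolded.  BoxL keeps its principal formula,
  so without this set saturation would not terminate.\<close>
definition saturated :: "'a afm set \<Rightarrow> 'a afm set \<Rightarrow> 'a afm set \<Rightarrow> bool" where
  "saturated X L R \<longleftrightarrow> ABot \<notin> L \<and>
     (\<forall>A B. AImp A B \<in> L \<longrightarrow> A \<in> R \<or> B \<in> L) \<and>
     (\<forall>A B. AImp A B \<in> R \<longrightarrow> A \<in> L \<and> B \<in> R) \<and>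
     (\<forall>n A. ABox n A \<in> L \<longrightarrow> A \<in> L \<or> ABox n A \<in> X) \<and>
     unprovable_primes L R"

section \<open>Saturation of unprovable sequents\<close>

lemma prime_simps [simp]:
  "\<not> prime ABot" "prime (AAt P)" "\<not> prime (AImp A B)" "prime (ABox n A)"
  by (auto simp: prime_def)

lemma unprovable_primes_insert:
  "\<not> prime C \<Longrightarrow> unprovable_primes (insert C L) R = unprovable_primes L R"
  "\<not> prime C \<Longrightarrow> unprovable_primes L (insert C R) = unprovable_primes L R"
  unfolding unprovable_primes_def by auto

lemma saturated_AImp_left:
  assumes "saturated X L R" "A \<in> R \<or> B \<in> L"
  shows "saturated X (insert (AImp A B) L) R"
  using assms unfolding saturated_def by (auto simp: unprovable_primes_insert)

lemma saturated_AImp_right: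
  assumes "saturated X L R" "A \<in> L" "B \<in> R"
  shows "saturated X L (insert (AImp A B) R)"
  using assms unfolding saturated_def by (auto simp: unprovable_primes_insert)

lemma saturated_AAt: "saturated (insert (AAt P) X) L R \<Longrightarrow> saturated X L R"
  unfolding saturated_def by simp

lemma saturated_ABox: "saturated (insert (ABox n A) X) L R \<Longrightarrow> A \<in> L \<Longrightarrow> saturated X L R"
  unfolding saturated_def by (metis insertE afm.inject(3))

text \<open>Nothing is left to decompose, and every Box of the antecedent is excused as a member of
  the first argument.\<close>

lemma saturated_prime:
  assumes "\<not> prv X Y" "\<forall>C\<in>set X. prime C" "\<forall>C\<in>set Y. prime C \<or> C = ABot"
  shows "saturated (set X) (set X) (set Y)"
  unfolding saturated_def
proof (intro conjI allI impI)
  show "unprovable_primes (set X) (set Y)"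
    using assms(1) unfolding unprovable_primes_def by blast
qed (use assms(2,3) in fastforce)+

lemma size_pos: "0 < size (C :: 'a afm)"
  by (cases C) auto

text \<open>Here \<open>X\<close> and \<open>Y\<close> hold processed formulas, \<open>G\<close> and
  \<open>D\<close> pending ones, and the induction is on the total size of the pending ones. Each
  step reads a rule upwards and keeps an unprovable premise.\<close>

lemma saturate:
  fixes X G Y D :: "'a afm list"
  assumes "\<not> prv (X @ G) (Y @ D)" "\<forall>C\<in>set X. prime C" "\<forall>C\<in>set Y. prime C \<or> C = ABot"
  shows "\<exists>L R. set X \<union> set G \<subseteq> L \<and> set Y \<union> set D \<subseteq> R \<and> saturated (set X) L R"
  using assms
proof (induction "sum_list (map size G) + sum_list (map size D)" arbitrary: X Y G D rule: less_induct)
  case less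
  have IH: "\<exists>L R. set X1 \<union> set G1 \<subseteq> L \<and> set Y1 \<union> set D1 \<subseteq> R \<and> saturated (set X1) L R"
    if "sum_list (map size G1) + sum_list (map size D1) < sum_list (map size G) + sum_list (map size D)"
      "\<not> prv (X1 @ G1) (Y1 @ D1)" "\<forall>C\<in>set X1. prime C" "\<forall>C\<in>set Y1. prime C \<or> C = ABot"
    for X1 G1 Y1 D1 :: "'a afm list"
    using less(1)[OF that] .
  consider (L) C G' where "G = C # G'" | (R) C D' where "G = []" "D = C # D'" | "G = []" "D = []"
    by (cases G; cases D) auto
  then show ?case
  proof cases
    case (L C G')
    have p: "\<not> prv (C # X @ G') (Y @ D)"
      using less(2) prv_perm[of "C # X @ G'" "Y @ D" "X @ G" "Y @ D"] L by auto
    show ?thesis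
    proof (cases C)
      case ABot
      then show ?thesis using p prv_BotL by blast
    next
      case (AAt P)
      obtain L' R' where *: "set (C # X) \<union> set G' \<subseteq> L'" "set Y \<union> set D \<subseteq> R'"
        "saturated (set (C # X)) L' R'"
        using IH[of G' D "C # X" Y] p less(3,4) by (auto simp: L AAt)
      have "saturated (set X) L' R'" using *(3) AAt saturated_AAt by simp
      moreover have "set X \<union> set G \<subseteq> L'" using *(1) by (simp add: L)
      ultimately show ?thesis using *(2) by blast
    next
      case (AImp A B)
      then have "\<not> prv (X @ G') (A # Y @ D) \<or> \<not> prv (B # X @ G') (Y @ D)"
        using p prv_ImpL by blast
      then have "\<exists>L R. set X \<union> set G' \<subseteq> L \<and> set Y \<union> set D \<subseteq> R \<and> (A \<in> R \<or> B \<in> L) \<and>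
        saturated (set X) L R"
      proof
        assume "\<not> prv (X @ G') (A # Y @ D)"
        then have "\<not> prv (X @ G') (Y @ A # D)"
          using prv_perm[of "X @ G'" "Y @ A # D" "X @ G'" "A # Y @ D"] by auto
        then obtain L' R' where "set X \<union> set G' \<subseteq> L'" "set Y \<union> set (A # D) \<subseteq> R'"
          "saturated (set X) L' R'"
          using IH[of G' "A # D" X Y] less(3,4) by (auto simp: L AImp)
        then show ?thesis by (intro exI[of _ L'] exI[of _ R']) simp
      next
        assume "\<not> prv (B # X @ G') (Y @ D)"
        then have "\<not> prv (X @ B # G') (Y @ D)"
          using prv_perm[of "X @ B # G'" "Y @ D" "B # X @ G'" "Y @ D"] by auto
        then obtain L' R' where "set X \<union> set (B # G') \<subseteq> L'" "set Y \<union> set D \<subseteq> R'"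
          "saturated (set X) L' R'"
          using IH[of "B # G'" D X Y] less(3,4) by (auto simp: L AImp)
        then show ?thesis by (intro exI[of _ L'] exI[of _ R']) simp
      qed
      then obtain L' R' where *: "set X \<union> set G' \<subseteq> L'" "set Y \<union> set D \<subseteq> R'"
        "saturated (set X) (insert C L') R'"
        using saturated_AImp_left AImp by metis
      have "set X \<union> set G \<subseteq> insert C L'" using *(1) by (auto simp: L)
      then show ?thesis using *(2,3) by blast
    next
      case (ABox n A)
      then have "\<not> prv (A # C # X @ G') (Y @ D)"
        using prv_BoxL[of A n "X @ G'" "Y @ D"] p by blast
      then have "\<not> prv ((C # X) @ A # G') (Y @ D)"
        using prv_perm[of "(C # X) @ A # G'" "Y @ D" "A # C # X @ G'" "Y @ D"] by auto
      then obtain L' R' where *: "set (C # X) \<union> set (A # G') \<subseteq> L'" "set Y \<union> set D \<subseteq> R'"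
        "saturated (set (C # X)) L' R'"
        using IH[of "A # G'" D "C # X" Y] less(3,4) by (auto simp: L ABox)
      \<comment> \<open>The principal Box moved to the processed part while its body was queued. The
        body is now in \<open>L'\<close>, so the Box needs no excuse any more.\<close>
      have "saturated (set X) L' R'"
        using saturated_ABox[of n A "set X" L' R'] *(1,3) ABox by simp
      moreover have "set X \<union> set G \<subseteq> L'" using *(1) by (simp add: L)
      ultimately show ?thesis using *(2) by blast
    qed
  next
    case (R C D')
    have p: "\<not> prv (X @ G) (C # Y @ D')"
      using less(2) prv_perm[of "X @ G" "C # Y @ D'" "X @ G" "Y @ D"] R by auto
    show ?thesis
    proof (cases "\<exists>A B. C = AImp A B")
      case True
      then obtain A B where AImp: "C = AImp A B" by blast
      then have "\<not> prv (A # X @ G) (B # Y @ D')" using p prv_ImpR by blast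
      then have "\<not> prv (X @ A # G) (Y @ B # D')"
        using prv_perm[of "X @ A # G" "Y @ B # D'" "A # X @ G" "B # Y @ D'"] by auto
      then obtain L' R' where *: "set X \<union> set (A # G) \<subseteq> L'" "set Y \<union> set (B # D') \<subseteq> R'"
        "saturated (set X) L' R'"
        using IH[of "A # G" "B # D'" X Y] less(3,4) by (auto simp: R AImp)
      have "saturated (set X) L' (insert C R')"
        using * AImp saturated_AImp_right[of "set X" L' R' A B] by simp
      moreover have "set Y \<union> set D \<subseteq> insert C R'" using *(2) by (auto simp: R)
      moreover have "set X \<union> set G \<subseteq> L'" using *(1) by simp
      ultimately show ?thesis by blast
    next
      case False
      then have C: "prime C \<or> C = ABot" by (cases C) (auto simp: prime_def)
      obtain L' R' where *: "set X \<union> set G \<subseteq> L'" "set (C # Y) \<union> set D' \<subseteq> R'"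
        "saturated (set X) L' R'"
        using IH[of G D' X "C # Y"] p C less(3,4) size_pos[of C] by (auto simp: R)
      then have "set Y \<union> set D \<subseteq> R'" by (simp add: R)
      then show ?thesis using *(1,3) by blast
    qed
  next
    case 3
    then show ?thesis using saturated_prime[of X Y] less(2-4) by auto
  qed
qed

text \<open>Saturation starts with no processed Box, so in the result every Box on the left is
  unfolded. The remaining clauses come from the unprovable sequent of primes.\<close>

lemma hintikka_extension:
  assumes "\<not> prv G D"
  shows "\<exists>w. hintikka w \<and> set G \<subseteq> fst w \<and> set D \<subseteq> snd w"
proof -
  obtain L R X Y where *: "set G \<subseteq> L" "set D \<subseteq> R" "\<not> prv X Y" "\<forall>C\<in>L. prime C \<longrightarrow> C \<in> set X"
    "\<forall>C\<in>R. prime C \<longrightarrow> C \<in> set Y" "ABot \<notin> L" "\<forall>A B. AImp A B \<in> L \<longrightarrow> A \<in> R \<or> B \<in> L"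
    "\<forall>A B. AImp A B \<in> R \<longrightarrow> A \<in> L \<and> B \<in> R" "\<forall>n A. ABox n A \<in> L \<longrightarrow> A \<in> L"
  proof -
    obtain L R where LR: "set G \<subseteq> L" "set D \<subseteq> R" "saturated {} L R"
      using saturate[of "[]" G "[]" D] assms by auto
    then obtain X Y where XY: "\<not> prv X Y" "\<forall>C\<in>L. prime C \<longrightarrow> C \<in> set X"
      "\<forall>C\<in>R. prime C \<longrightarrow> C \<in> set Y"
      unfolding saturated_def unprovable_primes_def by blast
    show ?thesis
      by (rule that[OF LR(1,2) XY]) (use LR(3) in \<open>simp_all add: saturated_def\<close>)
  qed
  \<comment> \<open>A shared atom would turn the unprovable sequent into an axiom, up to
    order.\<close>
  have atoms: "AAt P \<notin> R" if "AAt P \<in> L" for P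
  proof
    assume "AAt P \<in> R"
    then have "AAt P \<in> set X" "AAt P \<in> set Y" using *(4,5) that by simp_all
    then have m: "mset X = mset (AAt P # remove1 (AAt P) X)" "mset Y = mset (AAt P # remove1 (AAt P) Y)"
      by simp_all
    show False using prv_perm[OF prv_Ax m] *(3) by contradiction
  qed
  have boxes: "\<exists>X. {C \<in> L. boxed C \<and> below n C} \<subseteq> set X \<and> \<not> prv X [A]"
    if "ABox n A \<in> R" "below n A" for n A
  proof -
    let ?b = "\<lambda>C. boxed C \<and> below n C"
    have "ABox n A \<in> set Y" using that *(5) by simp
    then have m: "mset Y = mset (ABox n A # remove1 (ABox n A) Y)" by simp
    \<comment> \<open>Otherwise BoxR would prove the sequent, with the rest of \<open>X\<close> and
      \<open>Y\<close> as weakening formulas.\<close>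
    have "\<not> prv (filter ?b X) [A]"
    proof
      assume "prv (filter ?b X) [A]"
      then have p: "prv (filter ?b X @ filter (\<lambda>C. \<not> ?b C) X) (ABox n A # remove1 (ABox n A) Y)"
        by (rule prv_BoxR) (use that in auto)
      have "mset X = mset (filter ?b X @ filter (\<lambda>C. \<not> ?b C) X)"
        by (simp only: mset_append mset_filter multiset_partition[symmetric])
      from prv_perm[OF p this m] *(3) show False by contradiction
    qed
    moreover have "{C \<in> L. ?b C} \<subseteq> set (filter ?b X)" using *(4) unfolding prime_def by auto
    ultimately show ?thesis by blast
  qed
  have "hintikka (L, R)"
    unfolding hintikka_def fst_conv snd_conv
    by (intro conjI *(6-9)) (use atoms boxes in blast)+
  then show ?thesis using *(1,2) by (metis fst_conv snd_conv)
qed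

text \<open>The inherited formulas are those that a BoxR step numbered \<open>m\<close> may carry
  into its premise.\<close>

definition canS :: "nat \<Rightarrow> 'a afm set \<times> 'a afm set \<Rightarrow> 'a afm set \<times> 'a afm set \<Rightarrow> bool" where
  "canS m w v \<longleftrightarrow> hintikka v \<and> {C \<in> fst w. boxed C \<and> below m C} \<subseteq> fst v"

definition canV :: "'a afm set \<times> 'a afm set \<Rightarrow> 'a \<Rightarrow> bool" where
  "canV w P \<longleftrightarrow> AAt P \<in> fst w"

text \<open>In the Box case, a Box on the left is copied along each admissible step, and a Box on
  the right is witnessed by extending its stored unprovable premise to a world.\<close>

lemma truth_lemma:
  assumes "hintikka w"
  shows "(A \<in> fst w \<longrightarrow> sat canS canV A True w) \<and> (A \<in> snd w \<longrightarrow> sat canS canV A False w)"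
  using assms
proof (induction A arbitrary: w)
  case ABot
  then show ?case by (auto simp: hintikka_def)
next
  case (AAt P)
  then show ?case by (auto simp: hintikka_def canV_def)
next
  case (AImp A B)
  have "AImp A B \<in> fst w \<longrightarrow> A \<in> snd w \<or> B \<in> fst w" "AImp A B \<in> snd w \<longrightarrow> A \<in> fst w \<and> B \<in> snd w"
    using AImp.prems unfolding hintikka_def by blast+
  then show ?case using AImp.IH(1)[OF AImp.prems] AImp.IH(2)[OF AImp.prems] by auto
next
  case (ABox n A)
  have "sat canS canV (ABox n A) True w" if B: "ABox n A \<in> fst w"
  proof -
    have "hintikka v \<and> ABox n A \<in> fst v" if "(w, v) \<in> acc canS (\<lambda>m. below m (ABox n A))" for v
      using that B ABox.prems unfolding acc_def
      by (induction rule: rtrancl_induct) (auto simp: canS_def)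
    moreover have "sat canS canV A True v" if "hintikka v \<and> ABox n A \<in> fst v" for v
    proof -
      have "A \<in> fst v" using that unfolding hintikka_def by blast
      then show ?thesis using ABox.IH[of v] that by blast
    qed
    ultimately show ?thesis by simp
  qed
  moreover have "sat canS canV (ABox n A) False w" if B: "ABox n A \<in> snd w"
  proof (cases "below n A")
    case True
    then obtain X where X: "{C \<in> fst w. boxed C \<and> below n C} \<subseteq> set X" "\<not> prv X [A]"
      using ABox.prems B unfolding hintikka_def by blast
    then obtain u where u: "hintikka u" "set X \<subseteq> fst u" "A \<in> snd u"
      using hintikka_extension[OF X(2)] by auto
    have v: "canS n w u" using X(1) u unfolding canS_def by blast
    have "sat canS canV A False u" using ABox.IH[OF u(1)] u(3) by blast
    \<comment> \<open>A single step with number \<open>n\<close> itself suffices.\<close>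
    moreover have "(w, u) \<in> acc canS (\<lambda>m. n \<le> m)" unfolding acc_def using v by blast
    ultimately have "\<exists>v. (w, v) \<in> acc canS (\<lambda>m. n \<le> m) \<and> sat canS canV A False v" by blast
    then show ?thesis by simp
  qed simp
  ultimately show ?case by blast
qed

section \<open>Labels from cycle-freeness\<close>

lemma finite_paths: "finite {p. subfm A p \<noteq> None}"
proof (induction A)
  case Bot
  have "{p. subfm Bot p \<noteq> None} \<subseteq> {[]}" by (auto, metis list.exhaust option.distinct(1) subfm.simps(5))
  then show ?case by (rule finite_subset) simp
next
  case (At P)
  have "{p. subfm (At P) p \<noteq> None} \<subseteq> {[]}" by (auto, metis list.exhaust option.distinct(1) subfm.simps(6))
  then show ?case by (rule finite_subset) simp
next
  case (Imp A B)
  have "{p. subfm (Imp A B) p \<noteq> None} \<subseteq>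
    insert [] ((#) 0 ` {p. subfm A p \<noteq> None} \<union> (#) (Suc 0) ` {p. subfm B p \<noteq> None})"
  proof
    fix p assume "p \<in> {p. subfm (Imp A B) p \<noteq> None}"
    then show "p \<in> insert [] ((#) 0 ` {p. subfm A p \<noteq> None} \<union> (#) (Suc 0) ` {p. subfm B p \<noteq> None})"
      by (cases "(Imp A B, p)" rule: subfm.cases) auto
  qed
  then show ?case by (rule finite_subset) (intro finite_insert[THEN iffD2] finite_UnI finite_imageI Imp)
next
  case (Box A)
  have "{p. subfm (Box A) p \<noteq> None} \<subseteq> insert [] ((#) 0 ` {p. subfm A p \<noteq> None})"
  proof
    fix p assume "p \<in> {p. subfm (Box A) p \<noteq> None}"
    then show "p \<in> insert [] ((#) 0 ` {p. subfm A p \<noteq> None})"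
      by (cases "(Box A, p)" rule: subfm.cases) auto
  qed
  then show ?case by (rule finite_subset) (intro finite_insert[THEN iffD2] finite_imageI Box)
qed

lemma finite_addresses: "finite {a. node_at a t \<noteq> None}"
proof (induction t)
  case (PT c r ts)
  have "{a. node_at a (PT c r ts) \<noteq> None} \<subseteq>
    insert [] (\<Union>k<length ts. (#) k ` {a. node_at a (ts ! k) \<noteq> None})"
  proof
    fix a assume "a \<in> {a. node_at a (PT c r ts) \<noteq> None}"
    then show "a \<in> insert [] (\<Union>k<length ts. (#) k ` {a. node_at a (ts ! k) \<noteq> None})"
      by (cases a) (auto split: if_splits)
  qed
  then show ?case by (rule finite_subset) (intro finite_insert[THEN iffD2] finite_UN_I finite_lessThan finite_imageI PT, simp)
qed

lemma finite_boxes: "finite {x. is_box t x}"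
proof -
  let ?l = "\<lambda>a s. (if s then fst (root (the (node_at a t))) else snd (root (the (node_at a t))))"
  have "{x. is_box t x} \<subseteq> (\<Union>a\<in>{a. node_at a t \<noteq> None}. \<Union>s\<in>UNIV. \<Union>i\<in>{..<length (?l a s)}.
     (\<lambda>p. (a, s, i, p)) ` {p. subfm (?l a s ! i) p \<noteq> None})"
    unfolding is_box_def by (auto simp: Let_def image_iff split: option.splits if_splits)
  then show ?thesis by (rule finite_subset) (intro finite_UN_I finite_imageI finite_addresses finite_paths finite finite_lessThan)
qed

text \<open>An occurrence is numbered by how many prehistoric ancestors it has. There are finitely
  many, so strict inclusion of ancestor sets gives strictly smaller cardinality.\<close>

lemma cycle_free_good_labels:
  assumes "cycle_free t"
  shows "\<exists>f. good_labels t f"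
proof -
  define f where "f = (\<lambda>x. card {y. (y, x) \<in> (prehist t)\<^sup>+})"
  have fin: "finite {y. (y, x) \<in> (prehist t)\<^sup>+}" for x
  proof (rule finite_subset[OF _ finite_boxes[of t]])
    have "is_box t y" if "(y, x) \<in> (prehist t)\<^sup>+" for y
      using that by (induction rule: converse_trancl_induct) (auto simp: prehist_def)
    then show "{y. (y, x) \<in> (prehist t)\<^sup>+} \<subseteq> {x. is_box t x}" by blast
  qed
  have less: "f x < f y" if "(x, y) \<in> prehist t" for x y
    unfolding f_def
  proof (rule psubset_card_mono[OF fin])
    \<comment> \<open>Acyclicity makes \<open>x\<close> itself the element that distinguishes the
      two ancestor sets.\<close>
    have "x \<notin> {z. (z, x) \<in> (prehist t)\<^sup>+}" "x \<in> {z. (z, y) \<in> (prehist t)\<^sup>+}"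
      using assms that unfolding cycle_free_def by blast+
    moreover have "{z. (z, x) \<in> (prehist t)\<^sup>+} \<subseteq> {z. (z, y) \<in> (prehist t)\<^sup>+}"
      using that by (auto intro: trancl_into_trancl)
    ultimately show "{z. (z, x) \<in> (prehist t)\<^sup>+} \<subset> {z. (z, y) \<in> (prehist t)\<^sup>+}" by blast
  qed
  have ph: "(z, y) \<in> prehist t" if "(y, x) \<in> corr t" "is_box t y" "(z, x) \<in> prehist t" for x y z
  proof -
    obtain a n s i p where *: "is_box t z" "node_at a t = Some n" "rule_of n = BoxR"
      "is_box t (a @ [0], s, i, p)" "(z, (a @ [0], s, i, p)) \<in> corr t"
      "(x, (a, False, 0, [])) \<in> corr t"
      using \<open>(z, x) \<in> prehist t\<close> unfolding prehist_def mem_Collect_eq case_prod_conv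
      by (elim exE conjE)
    have "(y, (a, False, 0, [])) \<in> corr t"
      using that(1) *(6) unfolding corr_def by (rule rtrancl_trans)
    then show ?thesis
      unfolding prehist_def mem_Collect_eq case_prod_conv using *(1-5) that(2) by blast
  qed
  have sub: "{z. (z, x) \<in> (prehist t)\<^sup>+} \<subseteq> {z. (z, y) \<in> (prehist t)\<^sup>+}"
    if "(y, x) \<in> corr t" "is_box t y" for x y
  proof
    fix z assume "z \<in> {z. (z, x) \<in> (prehist t)\<^sup>+}"
    \<comment> \<open>To redirect a chain from \<open>x\<close> to the corresponding
      \<open>y\<close>, only its last link has to change, which \<open>ph\<close> allows.\<close>
    then have "(z, x) \<in> (prehist t)\<^sup>* O prehist t" by (simp add: trancl_unfold_right)
    then have "(z, y) \<in> (prehist t)\<^sup>* O prehist t" using ph[OF that] by blast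
    then show "z \<in> {z. (z, y) \<in> (prehist t)\<^sup>+}" by (simp add: trancl_unfold_right)
  qed
  have "f x = f y" if "(x, y) \<in> dcorr t" "is_box t x" "is_box t y" for x y
  proof -
    have "(x, y) \<in> corr t" "(y, x) \<in> corr t" using that(1) unfolding corr_def by blast+
    then show ?thesis using sub that unfolding f_def by (metis subset_antisym)
  qed
  moreover have "f (a @ [0], s, i, p) < f (a, False, 0, [])"
    if "node_at a t = Some n" "rule_of n = BoxR" "is_box t (a @ [0], s, i, p)" "is_box t (a, False, 0, [])"
    for a n s i p
  proof (rule less)
    have "(x, x) \<in> corr t" for x unfolding corr_def by simp
    then show "((a @ [0], s, i, p), (a, False, 0, [])) \<in> prehist t"
      using that unfolding prehist_def by blast
  qed
  ultimately show ?thesis unfolding good_labels_def by blast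
qed

text \<open>The numbers of the given proof are used only to annotate its root sequent and to show,
  by soundness, that no canonical world refutes it. Completeness then gives a new, cut-free numbered
  proof, which is cycle-free by \<open>labelling_cycle_free\<close>.\<close>

lemma cf_provable_imp_G3s:
  assumes "cf_provable sys \<Gamma> \<Delta>"
  shows "cf_provable G3s \<Gamma> \<Delta>"
proof -
  obtain t where t: "valid sys t" "mset (fst (root t)) = \<Gamma>" "mset (snd (root t)) = \<Delta>" "cycle_free t"
    using assms unfolding cf_provable_def by (elim exE conjE)
  obtain f where f: "good_labels t f" using cycle_free_good_labels[OF t(4)] by blast
  define G where "G = map (\<lambda>i. lab f [] None True i [] (fst (root t) ! i)) [0..<length (fst (root t))]"
  define D where "D = map (\<lambda>i. lab f [] None False i [] (snd (root t) ! i)) [0..<length (snd (root t))]"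
  have "prv G D"
  proof (rule ccontr)
    assume "\<not> prv G D"
    then obtain w where w: "hintikka w" "set G \<subseteq> fst w" "set D \<subseteq> snd w"
      using hintikka_extension by blast
    have "refuted canS canV f [] None (root t) w"
      unfolding refuted_def
    proof (intro conjI allI impI)
      fix i assume "i < length (fst (root t))"
      then have "lab f [] None True i [] (fst (root t) ! i) \<in> fst w" using w(2) by (auto simp: G_def)
      then show "sat canS canV (lab f [] None True i [] (fst (root t) ! i)) True w"
        using truth_lemma[OF w(1)] by blast
    next
      fix i assume "i < length (snd (root t))"
      then have "lab f [] None False i [] (snd (root t) ! i) \<in> snd w" using w(3) by (auto simp: D_def)
      then show "sat canS canV (lab f [] None False i [] (snd (root t) ! i)) False w"
        using truth_lemma[OF w(1)] by blast
    qed
    then show False using soundness[OF t(1) _ f] by (metis node_at.simps(1))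
  qed
  then obtain t' F where t': "valid G3s t'" "labelling t' F" "F [] = (G, D)"
    unfolding prv_def by blast
  have "root t' = eraseq (F [])" using t'(2) unfolding labelling_def by (metis node_at.simps(1))
  moreover have "map erase G = fst (root t)" "map erase D = snd (root t)"
    by (rule nth_equalityI; simp add: G_def D_def lab_def)+
  ultimately have "root t' = root t" by (simp add: t'(3) eraseq_def)
  then show ?thesis unfolding cf_provable_def using t t'(1) labelling_cycle_free[OF t'(2)] by metis
qed

lemma valid_G3s_imp: "valid G3s t \<Longrightarrow> valid sys t"
proof (induction rule: valid.induct)
  case (1 r s ts)
  then show ?case by (intro valid.intros) (cases r; auto)+
qed

lemma cf_provable_iff_G3s: "cf_provable sys \<Gamma> \<Delta> \<longleftrightarrow> cf_provable G3s \<Gamma> \<Delta>"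
proof
  assume "cf_provable G3s \<Gamma> \<Delta>"
  then show "cf_provable sys \<Gamma> \<Delta>"
    unfolding cf_provable_def using valid_G3s_imp by (elim exE conjE) (intro exI conjI)
qed (rule cf_provable_imp_G3s)

theorem mainTheorem6:
  fixes \<Gamma> \<Delta> :: "'a fm multiset"
  shows "(cf_provable G3s_BoxCut \<Gamma> \<Delta> \<longleftrightarrow> cf_provable G3s_Cut \<Gamma> \<Delta>) \<and>
         (cf_provable G3s_Cut \<Gamma> \<Delta> \<longleftrightarrow> cf_provable G3s \<Gamma> \<Delta>)"
  unfolding cf_provable_iff_G3s[of G3s_BoxCut] cf_provable_iff_G3s[of G3s_Cut] by simp

end
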